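(* Let $\mathcal{F}=\{f_i : i\in I\}$, $I=\{1,\ldots,k\}$, be an iterated function system of similarities on a Euclidean space $\mathbb{R}^d$ satisfying the open set condition, and let $K$ be its attractor. Let $c\in(0,1)$ be the common similarity factor of all the similarities $f_i$. Let $\mathbf{\Gamma}$ be the natural fractal structure on $K$ as a self-similar set. Then the box dimension $\dim_B(K)$ and the fractal dimension II $\dim_{\mathbf{\Gamma}}^2(K)$ satisfy $$\dim_B(K)=\dim_{\mathbf{\Gamma}}^2(K)=\frac{-\log k}{\log c}.$$
   Context: A similarity on a metric space $(X,\rho)$ with similarity factor $c>0$ is a map $f:X\to X$ with $\rho(f(x),f(y))=c\,\rho(x,y)$ for all $x,y\in X$. An iterated function system (IFS) is a finite family $\mathcal{F}=\{f_i:i\in I\}$, $I=\{1,\ldots,k\}$, of similarities; it is Euclidean if $X=\mathbb{R}^d$. Its attractor (self-similar set) is the unique non-empty compact set $K\subset X$ with $K=\bigcup_{i\in I}f_i(K)$. Open set condition: there is a non-empty bounded open set $V\subset\mathbb{R}^d$ such that $\bigcup_{i\in I}f_i(V)\subset V$ with this union disjoint. A fractal structure on a set $X$ is a countable family $\mathbf{\Gamma}=\{\Gamma_n:n\in\mathbb{N}\}$ of coverings of $X$ (called levels) such that for all $n$: every $A\in\Gamma_{n+1}$ is contained in some $B\in\Gamma_n$, and every $B\in\Gamma_n$ satisfies $B=\bigcup\{A\in\Gamma_{n+1}:A\subseteq B\}$. A set is allowed to appear more than once in a level (levels are families counted with multiplicity). The natural fractal structure on the attractor $K$ has levels $\Gamma_n=\{f_\omega(K):\omega\in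 I^n\}$, where $f_\omega=f_{\omega_1}\circ\cdots\circ f_{\omega_n}$ for $\omega=\omega_1\ldots\omega_n$; the family is indexed by words $\omega\in I^n$, so it is counted with multiplicity. Box dimension of $F\subseteq\mathbb{R}^d$: $\dim_B(F)=\lim_{\delta\to0}\frac{\log N_\delta(F)}{-\log\delta}$, where $N_\delta(F)$ is the largest number of disjoint balls of radius $\delta$ with centres in $F$ (lower/upper box dimension: lower/upper limit). Fractal dimension II of $F$ with respect to $\mathbf{\Gamma}$: $\dim_{\mathbf{\Gamma}}^2(F)=\lim_{n\to\infty}\frac{\log N_n(F)}{-\log\delta(F,\Gamma_n)}$, where $N_n(F)$ is the number of elements of $\Gamma_n$ that intersect $F$ (with multiplicity) and $\delta(F,\Gamma_n)=\sup\{\operatorname{diam}(A):A\in\Gamma_n,\ A\cap F\neq\emptyset\}$ (lower/upper versions: lower/upper limit). Writing $\dim_B(K)$ or $\dim_{\mathbf{\Gamma}}^2(K)$ without qualification means that the corresponding limit exists. *)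

theory Defs
  imports "HOL-Analysis.Analysis"
begin

definition similarity :: "real \<Rightarrow> ('a::metric_space \<Rightarrow> 'a) \<Rightarrow> bool" where
  "similarity c f \<longleftrightarrow> c > 0 \<and> (\<forall>x y. dist (f x) (f y) = c * dist x y)"

text \<open>For a finite family of contractions on a complete space such a set exists and is unique
  (Hutchinson), so uniqueness is not part of the predicate.\<close>

definition is_attractor :: "'i set \<Rightarrow> ('i \<Rightarrow> 'a::topological_space \<Rightarrow> 'a) \<Rightarrow> 'a set \<Rightarrow> bool" where
  "is_attractor I f K \<longleftrightarrow> K \<noteq> {} \<and> compact K \<and> K = (\<Union>i\<in>I. f i ` K)"

definition open_set_condition :: "'i set \<Rightarrow> ('i \<Rightarrow> 'a::metric_space \<Rightarrow> 'a) \<Rightarrow> bool" where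
  "open_set_condition I f \<longleftrightarrow>
     (\<exists>V. V \<noteq> {} \<and> bounded V \<and> open V \<and> (\<Union>i\<in>I. f i ` V) \<subseteq> V \<and>
          disjoint_family_on (\<lambda>i. f i ` V) I)"

text \<open>A level of a fractal structure is counted with multiplicity: it is an index set together with
  a family of sets.\<close>

type_synonym ('w, 'a) level = "'w set \<times> ('w \<Rightarrow> 'a set)"

definition fractal_structure :: "'a set \<Rightarrow> (nat \<Rightarrow> ('w, 'a) level) \<Rightarrow> bool" where
  "fractal_structure X \<Gamma> \<longleftrightarrow>
     (\<forall>n. let (J, A) = \<Gamma> n; (J', A') = \<Gamma> (Suc n) in
        (\<Union>w\<in>J. A w) = X \<and>
        (\<forall>v\<in>J'. \<exists>w\<in>J. A' v \<subseteq> A w) \<and>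
        (\<forall>w\<in>J. A w = \<Union>{A' v | v. v \<in> J' \<and> A' v \<subseteq> A w}))"

definition word_map :: "('i \<Rightarrow> 'a \<Rightarrow> 'a) \<Rightarrow> 'i list \<Rightarrow> 'a \<Rightarrow> 'a" where
  "word_map f \<omega> = foldr (\<circ>) (map f \<omega>) id"

definition natural_structure ::
    "'i set \<Rightarrow> ('i \<Rightarrow> 'a \<Rightarrow> 'a) \<Rightarrow> 'a set \<Rightarrow> nat \<Rightarrow> ('i list, 'a) level" where
  "natural_structure I f K n =
     ({\<omega>. set \<omega> \<subseteq> I \<and> length \<omega> = n}, \<lambda>\<omega>. word_map f \<omega> ` K)"

lemma word_map_simps [simp]:
  "word_map f [] = id"
  "word_map f (i # \<omega>) = f i \<circ> word_map f \<omega>"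
  "word_map f (\<omega> @ \<omega>') = word_map f \<omega> \<circ> word_map f \<omega>'"
proof -
  show *: "word_map f [] = id" "\<And>i \<omega>. word_map f (i # \<omega>) = f i \<circ> word_map f \<omega>"
    by (simp_all add: word_map_def)
  show "word_map f (\<omega> @ \<omega>') = word_map f \<omega> \<circ> word_map f \<omega>'"
    by (induction \<omega>) (simp_all add: * comp_assoc)
qed

lemma fractal_structure_natural_structure:
  assumes "is_attractor I f K"
  shows "fractal_structure K (natural_structure I f K)"
proof -
  let ?W = "\<lambda>n. {\<omega>. set \<omega> \<subseteq> I \<and> length \<omega> = n}"
  have K: "K = (\<Union>i\<in>I. f i ` K)"
    using assms by (simp add: is_attractor_def)
  have split: "word_map f \<omega> ` K = (\<Union>i\<in>I. word_map f (\<omega> @ [i]) ` K)" for \<omega>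
  proof -
    have "word_map f \<omega> ` K = word_map f \<omega> ` (\<Union>i\<in>I. f i ` K)"
      using K by (rule arg_cong)
    then show ?thesis
      by (simp add: image_UN image_comp)
  qed
  have cover: "(\<Union>\<omega>\<in>?W n. word_map f \<omega> ` K) = K" for n
  proof (induction n)
    case 0
    have "?W 0 = {[]}" by auto
    then show ?case by simp
  next
    case (Suc n)
    have "?W (Suc n) = (\<Union>i\<in>I. (#) i ` ?W n)"
      by (auto simp: length_Suc_conv image_iff)
    then have "(\<Union>\<omega>\<in>?W (Suc n). word_map f \<omega> ` K) =
        (\<Union>i\<in>I. \<Union>\<omega>\<in>?W n. word_map f (i # \<omega>) ` K)"
      by (simp only: UN_UN_flatten UN_simps)
    also have "\<dots> = (\<Union>i\<in>I. f i ` (\<Union>\<omega>\<in>?W n. word_map f \<omega> ` K))"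
      by (simp only: word_map_simps image_UN image_comp)
    also have "\<dots> = K"
      by (simp only: Suc.IH K[symmetric])
    finally show ?case .
  qed
  have refine: "\<exists>w\<in>?W n. word_map f v ` K \<subseteq> word_map f w ` K" if "v \<in> ?W (Suc n)" for v n
  proof -
    have "v \<noteq> []"
      using that by auto
    then obtain w i where v: "v = w @ [i]"
      by (metis rev_exhaust)
    have "word_map f v ` K \<subseteq> word_map f w ` K"
      unfolding split[of w] v using that v by (intro UN_upper) auto
    then show ?thesis
      using that v by (intro bexI[of _ w]) auto
  qed
  have union: "word_map f w ` K =
      \<Union>{word_map f v ` K | v. v \<in> ?W (Suc n) \<and> word_map f v ` K \<subseteq> word_map f w ` K}"
    (is "_ = \<Union>?S") if "w \<in> ?W n" for w n
  proof
    have "word_map f (w @ [i]) ` K \<in> ?S" if "i \<in> I" for i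
    proof -
      have "word_map f (w @ [i]) ` K \<subseteq> word_map f w ` K"
        unfolding split[of w] using that by (rule UN_upper)
      moreover have "w @ [i] \<in> ?W (Suc n)"
        using that \<open>w \<in> ?W n\<close> by auto
      ultimately show ?thesis by blast
    qed
    then have "(\<Union>i\<in>I. word_map f (w @ [i]) ` K) \<subseteq> \<Union>?S"
      by (intro UN_least Union_upper)
    then show "word_map f w ` K \<subseteq> \<Union>?S"
      by (simp only: split[of w, symmetric])
  qed blast
  show ?thesis
    unfolding fractal_structure_def natural_structure_def Let_def prod.case
    by (intro allI conjI ballI cover refine union)
qed

text \<open>Balls are closed. The set of cardinalities is bounded above whenever \<open>F\<close> is a bounded subset of
  a Euclidean space and \<open>\<delta> > 0\<close>; otherwise the value may be meaningless.\<close>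

definition ball_packing_number :: "real \<Rightarrow> 'a::metric_space set \<Rightarrow> nat" where
  "ball_packing_number \<delta> F =
     Sup {card \<B> | \<B>. finite \<B> \<and> \<B> \<subseteq> (\<lambda>x. cball x \<delta>) ` F \<and> disjoint \<B>}"

definition has_box_dim :: "'a::metric_space set \<Rightarrow> real \<Rightarrow> bool" where
  "has_box_dim F s \<longleftrightarrow>
     ((\<lambda>\<delta>. ln (real (ball_packing_number \<delta> F)) / - ln \<delta>) \<longlongrightarrow> s) (at_right 0)"

definition meeting_indices :: "('w, 'a) level \<Rightarrow> 'a set \<Rightarrow> 'w set" where
  "meeting_indices L F = {w \<in> fst L. snd L w \<inter> F \<noteq> {}}"

definition level_count :: "('w, 'a) level \<Rightarrow> 'a set \<Rightarrow> nat" where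
  "level_count L F = card (meeting_indices L F)"

definition level_diam :: "('w, 'a::metric_space) level \<Rightarrow> 'a set \<Rightarrow> real" where
  "level_diam L F = (SUP w\<in>meeting_indices L F. diameter (snd L w))"

text \<open>Meaningful when the levels are finite and consist of bounded sets. If \<open>level_diam (\<Gamma> n) F = 0\<close>,
  as happens for the natural structure of a one-point attractor, then \<open>ln 0 = 0\<close> makes the quotient
  \<open>0\<close>, which agrees with reading \<open>- log 0\<close> as infinity.\<close>

definition has_fractal_dim2 ::
    "(nat \<Rightarrow> ('w, 'a::metric_space) level) \<Rightarrow> 'a set \<Rightarrow> real \<Rightarrow> bool" where
  "has_fractal_dim2 \<Gamma> F s \<longleftrightarrow>
     (\<lambda>n. ln (real (level_count (\<Gamma> n) F)) / - ln (level_diam (\<Gamma> n) F)) \<longlonglongrightarrow> s"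

end

theory Submission imports Defs begin

text \<open>
  The open set condition enters through a single consequence, \<open>count_words_bounded\<close>: for a point
  \<open>p\<close> and a factor \<open>R\<close> there is a number \<open>M\<close> such that, whatever \<open>n\<close> is, at most \<open>M\<close> words \<open>\<omega>\<close> of
  length \<open>n\<close> send \<open>p\<close> into any one closed ball of radius \<open>R * c ^ n\<close>. To see this, fix a ball of
  radius \<open>r\<close> about a point \<open>a\<close> inside the open set. Its images under distinct words of length \<open>n\<close>
  are disjoint balls of radius \<open>c ^ n * r\<close>, so the points \<open>f\<^sub>\<omega> a\<close> are separated at the scale
  \<open>c ^ n\<close>, and by total boundedness only boundedly many of them fit into a ball of comparable
  radius.

  For the box dimension, choose \<open>n\<close> for a small \<open>\<delta>\<close> so that \<open>c ^ n\<close> is comparable to \<open>\<delta>\<close> and the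
  pieces \<open>f\<^sub>\<omega> K\<close> of level \<open>n\<close> have diameter at most \<open>\<delta>\<close>. Each of the \<open>k ^ n\<close> pieces contains at
  most one centre of a packing, so the packing number is at most \<open>k ^ n\<close>. Conversely, the centres
  of a maximal packing come within \<open>2 * \<delta>\<close> of each of the \<open>k ^ n\<close> points \<open>f\<^sub>\<omega> p\<close>, and each centre
  serves at most \<open>M\<close> of them, so the packing number is at least \<open>k ^ n / M\<close>. Hence its logarithm is
  \<open>n * ln k\<close> up to a bounded error, while \<open>- ln \<delta>\<close> is \<open>- n * ln c\<close> up to a bounded error.

  For fractal dimension II, all \<open>k ^ n\<close> words count and every piece of level \<open>n\<close> has diameter
  \<open>c ^ n * diameter K\<close>, so the limit is immediate once \<open>diameter K > 0\<close>. A one-point attractor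
  requires \<open>k = 1\<close>, since otherwise the \<open>k ^ n\<close> words would all send its point to itself, against
  the bound \<open>M\<close>; in that case both dimensions are \<open>0\<close>.
\<close>

section \<open>Quotients of asymptotically proportional functions\<close>

lemma tendsto_quotient_of_bounded_error:
  fixes g h :: "'b \<Rightarrow> real"
  assumes h: "filterlim h at_top F"
    and err: "eventually (\<lambda>x. \<bar>g x - s * h x\<bar> \<le> C) F"
  shows "((\<lambda>x. g x / h x) \<longlongrightarrow> s) F"
proof -
  have "((\<lambda>x. C / h x) \<longlongrightarrow> 0) F"
    by (rule tendsto_divide_0[OF tendsto_const])
       (use h filterlim_at_top_imp_at_infinity in blast)
  moreover have "eventually (\<lambda>x. norm (g x / h x - s) \<le> C / h x) F"
    using err filterlim_at_top_dense[THEN iffD1, OF h, rule_format, of 0]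
  proof eventually_elim
    case (elim x)
    have "g x / h x - s = (g x - s * h x) / h x"
      using elim by (simp add: field_simps)
    then have "norm (g x / h x - s) = \<bar>g x - s * h x\<bar> / h x"
      using elim by (simp add: abs_divide)
    then show ?case
      using elim by (simp add: divide_right_mono)
  qed
  ultimately have "((\<lambda>x. g x / h x - s) \<longlongrightarrow> 0) F"
    by (rule Lim_null_comparison[rotated])
  then show ?thesis
    by (simp add: LIM_zero_iff)
qed

section \<open>Similarities and separated sets in Euclidean spaces\<close>

text \<open>After moving the image of the origin back and rescaling, a similarity is an isometry fixing
  the origin, hence orthogonal and onto.\<close>

lemma similarity_surj:
  fixes f :: "'a::euclidean_space \<Rightarrow> 'a"
  assumes "similarity c f"
  shows "surj f"
proof -
  have c: "c > 0" and d: "\<And>x y. dist (f x) (f y) = c * dist x y"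
    using assms by (auto simp: similarity_def)
  define g where "g x = (f x - f 0) /\<^sub>R c" for x
  have "dist (g x) (g y) = dist x y" for x y
  proof -
    have "dist (g x) (g y) = norm ((f x - f y) /\<^sub>R c)"
      by (simp add: g_def dist_norm scaleR_diff_right)
    also have "\<dots> = dist (f x) (f y) / c"
      using c by (simp add: dist_norm divide_inverse mult.commute)
    finally show ?thesis
      using c d[of x y] by simp
  qed
  moreover have "g 0 = 0"
    by (simp add: g_def)
  ultimately have "orthogonal_transformation g"
    by (simp add: orthogonal_transformation_isometry)
  then have "surj g"
    by (rule orthogonal_transformation_surj)
  have "\<exists>x. y = f x" for y
  proof -
    obtain x where "g x = (y - f 0) /\<^sub>R c"
      using \<open>surj g\<close> by (metis surjD)
    then have "y = f x"
      using c by (simp add: g_def)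
    then show ?thesis ..
  qed
  then show ?thesis
    by (simp add: surj_def)
qed

lemma similarity_inj:
  assumes "similarity c f"
  shows "inj f"
  using assms by (intro injI) (metis dist_eq_0_iff less_irrefl mult_eq_0_iff similarity_def)

text \<open>Total boundedness of the ball of radius \<open>R\<close> gives a finite cover by balls of radius \<open>r / 2\<close>,
  each of which contains at most one point of an \<open>r\<close>-separated set. Translation and dilation make the
  bound independent of the centre \<open>x\<close> and of the scale \<open>t\<close>.\<close>

lemma card_separated_bounded:
  fixes r R :: real
  assumes "r > 0"
  obtains M :: nat where
    "\<And>(x::'a::euclidean_space) t S. t > 0 \<Longrightarrow> S \<subseteq> cball x (R * t) \<Longrightarrow>
       (\<And>y z. y \<in> S \<Longrightarrow> z \<in> S \<Longrightarrow> y \<noteq> z \<Longrightarrow> dist y z \<ge> r * t) \<Longrightarrow> finite S \<and> card S \<le> M"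
proof -
  have "compact (cball (0::'a) R)"
    by simp
  then obtain T where T: "finite T" "cball (0::'a) R \<subseteq> (\<Union>u\<in>T. ball u (r / 2))"
    using \<open>r > 0\<close> unfolding compact_eq_totally_bounded by (metis half_gt_zero)
  have bound: "finite S \<and> card S \<le> card T"
    if t: "t > 0" and S: "S \<subseteq> cball x (R * t)"
      and sep: "\<And>y z. y \<in> S \<Longrightarrow> z \<in> S \<Longrightarrow> y \<noteq> z \<Longrightarrow> dist y z \<ge> r * t" for x :: 'a and t S
  proof -
    define N where "N y = (y - x) /\<^sub>R t" for y
    have N_dist: "dist (N y) (N z) = dist y z / t" for y z
    proof -
      have "dist (N y) (N z) = norm ((y - z) /\<^sub>R t)"
        by (simp add: N_def dist_norm scaleR_diff_right)
      then show ?thesis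
        using t by (simp add: dist_norm divide_inverse mult.commute)
    qed
    have "\<exists>u\<in>T. dist u (N y) < r / 2" if "y \<in> S" for y
    proof -
      have "norm (N y) = dist x y / t"
        using t by (simp add: N_def dist_norm norm_minus_commute divide_inverse mult.commute)
      moreover have "dist x y \<le> R * t"
        using S that by auto
      ultimately have "norm (N y) \<le> R"
        using t by (simp add: pos_divide_le_eq)
      then show ?thesis
        using T(2) by (fastforce simp: subset_iff)
    qed
    then obtain u where u: "\<And>y. y \<in> S \<Longrightarrow> u y \<in> T \<and> dist (u y) (N y) < r / 2"
      by metis
    have "inj_on u S"
    proof (rule inj_onI, rule ccontr)
      fix y z assume yz: "y \<in> S" "z \<in> S" "u y = u z" "y \<noteq> z"
      have "dist (N y) (N z) < r"
        using u[OF yz(1)] u[OF yz(2)] yz(3) by (metis dist_commute dist_triangle_half_l)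
      then show False
        using sep[OF yz(1,2,4)] t by (simp add: N_dist field_simps)
    qed
    moreover have "u ` S \<subseteq> T"
      using u by auto
    ultimately show ?thesis
      using T(1) by (metis card_inj_on_le inj_on_finite)
  qed
  show thesis
    by (rule that, rule bound)
qed

section \<open>Words in a homogeneous iterated function system\<close>

locale homogeneous_ifs =
  fixes I :: "'i set" and f :: "'i \<Rightarrow> 'a::euclidean_space \<Rightarrow> 'a" and c :: real and K :: "'a set"
  assumes finite_I: "finite I"
    and c_pos: "0 < c" and c_less_1: "c < 1"
    and sim: "\<And>i. i \<in> I \<Longrightarrow> similarity c (f i)"
    and osc: "open_set_condition I f"
    and attractor: "is_attractor I f K"
begin

definition "words n = {\<omega>. set \<omega> \<subseteq> I \<and> length \<omega> = n}"

lemma finite_words: "finite (words n)"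
  unfolding words_def by (rule finite_lists_length_eq[OF finite_I])

lemma card_words: "card (words n) = card I ^ n"
  unfolding words_def by (rule card_lists_length_eq[OF finite_I])

lemma K_nonempty: "K \<noteq> {}" and K_compact: "compact K" and K_eq: "K = (\<Union>i\<in>I. f i ` K)"
  using attractor unfolding is_attractor_def by - (elim conjE, assumption)+

lemma card_I_pos: "card I > 0"
proof -
  have "I \<noteq> {}"
  proof
    assume "I = {}"
    then have "(\<Union>i\<in>I. f i ` K) = {}"
      by simp
    then show False
      using K_nonempty trans[OF K_eq] by blast
  qed
  then show ?thesis
    using finite_I by (simp add: card_gt_0_iff)
qed

lemma similarity_word_map:
  assumes "\<omega> \<in> words n"
  shows "similarity (c ^ n) (word_map f \<omega>)"
  using assms
proof (induction \<omega> arbitrary: n)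
  case Nil
  then show ?case by (simp add: words_def similarity_def)
next
  case (Cons i \<omega>)
  then obtain m where m: "n = Suc m" "\<omega> \<in> words m" "i \<in> I"
    by (auto simp: words_def)
  show ?case
    using Cons.IH[OF m(2)] sim[OF m(3)] by (simp add: similarity_def m)
qed

lemma dist_word_map:
  assumes "\<omega> \<in> words n"
  shows "dist (word_map f \<omega> x) (word_map f \<omega> y) = c ^ n * dist x y"
  using similarity_word_map[OF assms] by (simp add: similarity_def)

lemma word_pieces_cover: "(\<Union>\<omega>\<in>words n. word_map f \<omega> ` K) = K"
  using fractal_structure_natural_structure[OF attractor, unfolded fractal_structure_def
      natural_structure_def Let_def prod.case, THEN spec, of n]
  unfolding words_def by (rule conjunct1)

text \<open>Two different words of equal length have a first letter in which they differ. The common prefix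
  acts injectively, and what follows it lands in two disjoint sets \<open>f i ` V\<close> and \<open>f j ` V\<close>.\<close>

lemma word_images_disjoint:
  assumes V: "(\<Union>i\<in>I. f i ` V) \<subseteq> V" "disjoint_family_on (\<lambda>i. f i ` V) I"
    and "\<omega> \<in> words n" "\<eta> \<in> words n" "\<omega> \<noteq> \<eta>"
  shows "word_map f \<omega> ` V \<inter> word_map f \<eta> ` V = {}"
proof -
  have stays: "word_map f \<omega> ` V \<subseteq> V" if "set \<omega> \<subseteq> I" for \<omega>
    using that
  proof (induction \<omega>)
    case (Cons i \<omega>)
    then have "i \<in> I" "word_map f \<omega> ` V \<subseteq> V"
      by auto
    then have "f i ` word_map f \<omega> ` V \<subseteq> V"
      using V(1) by blast
    then show ?case
      by (simp add: image_comp)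
  qed simp
  have "length \<omega> = length \<eta>" "set \<omega> \<subseteq> I" "set \<eta> \<subseteq> I"
    using assms by (auto simp: words_def)
  then show ?thesis
    using \<open>\<omega> \<noteq> \<eta>\<close>
  proof (induction \<omega> \<eta> rule: list_induct2)
    case (Cons i \<omega> j \<eta>)
    show ?case
    proof (cases "i = j")
      case True
      then have "word_map f \<omega> ` V \<inter> word_map f \<eta> ` V = {}"
        using Cons.IH Cons.prems by simp
      moreover have "inj (f i)"
        using Cons.prems sim similarity_inj by (metis list.set_intros(1) subset_iff)
      ultimately have "f i ` word_map f \<omega> ` V \<inter> f i ` word_map f \<eta> ` V = {}"
        by (metis image_Int image_empty)
      then show ?thesis
        using True by (simp add: image_comp)
    next
      case False
      have "f i ` V \<inter> f j ` V = {}"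
        using V(2) False Cons.prems by (auto simp: disjoint_family_on_def)
      moreover have "f i ` word_map f \<omega> ` V \<subseteq> f i ` V" "f j ` word_map f \<eta> ` V \<subseteq> f j ` V"
        using stays Cons.prems by (auto intro!: image_mono)
      ultimately have "f i ` word_map f \<omega> ` V \<inter> f j ` word_map f \<eta> ` V = {}"
        by blast
      then show ?thesis
        by (simp add: image_comp)
    qed
  qed simp
qed

text \<open>Since \<open>word_map f \<omega>\<close> is onto, it carries a ball about \<open>a\<close> inside the open set onto the full
  ball of radius \<open>c ^ n * r\<close> about its image of \<open>a\<close>; disjointness then keeps the images of \<open>a\<close> under
  other words out of that ball.\<close>

lemma separated_orbit:
  obtains r a where "r > 0"
    "\<And>n \<omega> \<eta>. \<omega> \<in> words n \<Longrightarrow> \<eta> \<in> words n \<Longrightarrow> \<omega> \<noteq> \<eta> \<Longrightarrow>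
       dist (word_map f \<omega> a) (word_map f \<eta> a) \<ge> r * c ^ n"
proof -
  obtain V where V: "V \<noteq> {}" "open V" "(\<Union>i\<in>I. f i ` V) \<subseteq> V" "disjoint_family_on (\<lambda>i. f i ` V) I"
    using osc by (auto simp: open_set_condition_def)
  then obtain a r where ar: "a \<in> V" "r > 0" "ball a r \<subseteq> V"
    by (meson all_not_in_conv open_contains_ball)
  have "dist (word_map f \<omega> a) (word_map f \<eta> a) \<ge> r * c ^ n"
    if w: "\<omega> \<in> words n" "\<eta> \<in> words n" "\<omega> \<noteq> \<eta>" for n \<omega> \<eta>
  proof (rule ccontr)
    assume close: "\<not> ?thesis"
    obtain x where x: "word_map f \<omega> x = word_map f \<eta> a"
      using similarity_surj[OF similarity_word_map[OF w(1)]] by (metis surjD)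
    have "c ^ n * dist a x < r * c ^ n"
      using close dist_word_map[OF w(1), of a x] x by simp
    then have "x \<in> ball a r"
      using c_pos by (simp add: mult.commute)
    then have "word_map f \<eta> a \<in> word_map f \<omega> ` V \<inter> word_map f \<eta> ` V"
      using x ar by (metis IntI image_eqI subset_iff)
    then show False
      using word_images_disjoint[OF V(3,4) w] by blast
  qed
  then show thesis
    using ar(2) by (rule that[rotated])
qed

text \<open>Replacing \<open>a\<close> by \<open>p\<close> moves each orbit point by exactly \<open>c ^ n * dist a p\<close>, which only
  enlarges the radius by a constant multiple of \<open>c ^ n\<close>.\<close>

lemma count_words_bounded:
  obtains M :: nat where "\<And>n x. card {\<omega> \<in> words n. word_map f \<omega> p \<in> cball x (R * c ^ n)} \<le> M"
proof -
  obtain a r where r: "r > 0" and sep: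
    "\<And>n \<omega> \<eta>. \<omega> \<in> words n \<Longrightarrow> \<eta> \<in> words n \<Longrightarrow> \<omega> \<noteq> \<eta> \<Longrightarrow>
       dist (word_map f \<omega> a) (word_map f \<eta> a) \<ge> r * c ^ n"
    by (fact separated_orbit)
  obtain M :: nat where M:
    "\<And>(x::'a) t S. t > 0 \<Longrightarrow> S \<subseteq> cball x ((R + dist a p) * t) \<Longrightarrow>
       (\<And>y z. y \<in> S \<Longrightarrow> z \<in> S \<Longrightarrow> y \<noteq> z \<Longrightarrow> dist y z \<ge> r * t) \<Longrightarrow> finite S \<and> card S \<le> M"
    by (fact card_separated_bounded[OF r])
  have "card {\<omega> \<in> words n. word_map f \<omega> p \<in> cball x (R * c ^ n)} \<le> M" (is "card ?W \<le> M") for n x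
  proof -
    let ?e = "\<lambda>\<omega>. word_map f \<omega> a"
    have cn: "c ^ n > 0"
      using c_pos by simp
    have "inj_on ?e ?W"
    proof (rule inj_onI, rule ccontr)
      fix \<omega> \<eta> assume "\<omega> \<in> ?W" "\<eta> \<in> ?W" "?e \<omega> = ?e \<eta>" "\<omega> \<noteq> \<eta>"
      then have "r * c ^ n \<le> 0"
        using sep[of \<omega> n \<eta>] by simp
      then show False
        using r cn by (simp add: mult_le_0_iff)
    qed
    moreover have "card (?e ` ?W) \<le> M"
    proof -
      have "?e ` ?W \<subseteq> cball x ((R + dist a p) * c ^ n)"
      proof safe
        fix \<omega> assume w: "\<omega> \<in> words n" "word_map f \<omega> p \<in> cball x (R * c ^ n)"
        have "dist x (?e \<omega>) \<le> dist x (word_map f \<omega> p) + dist (word_map f \<omega> p) (?e \<omega>)"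
          by (rule dist_triangle)
        also have "\<dots> \<le> R * c ^ n + c ^ n * dist a p"
          using w by (simp add: dist_word_map dist_commute)
        finally show "?e \<omega> \<in> cball x ((R + dist a p) * c ^ n)"
          by (simp add: algebra_simps)
      qed
      then have "finite (?e ` ?W) \<and> card (?e ` ?W) \<le> M"
        by (rule M[OF cn]) (use sep in blast)
      then show ?thesis ..
    qed
    ultimately show ?thesis
      by (simp add: card_image)
  qed
  then show thesis
    by (rule that)
qed

section \<open>Packing numbers of the attractor\<close>

text \<open>A piece of level \<open>n\<close> has diameter at most \<open>\<delta>\<close>, so two centres in the same piece would give
  intersecting balls.\<close>

lemma card_packing_le:
  assumes \<B>: "\<B> \<subseteq> (\<lambda>x. cball x \<delta>) ` K" "disjoint \<B>"
    and \<delta>: "c ^ n * diameter K \<le> \<delta>"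
  shows "card \<B> \<le> card I ^ n"
proof -
  have "0 \<le> \<delta>"
    using \<delta> c_pos diameter_ge_0[OF compact_imp_bounded[OF K_compact]]
    by (metis less_imp_le mult_nonneg_nonneg order_trans zero_le_power)
  have "\<exists>x \<omega>. b = cball x \<delta> \<and> \<omega> \<in> words n \<and> x \<in> word_map f \<omega> ` K" if "b \<in> \<B>" for b
  proof -
    obtain x where "b = cball x \<delta>" "x \<in> K"
      using \<B>(1) \<open>b \<in> \<B>\<close> by blast
    moreover obtain \<omega> where "\<omega> \<in> words n" "x \<in> word_map f \<omega> ` K"
      using word_pieces_cover[of n] \<open>x \<in> K\<close> by blast
    ultimately show ?thesis by blast
  qed
  then obtain x \<omega> where x: "\<And>b. b \<in> \<B> \<Longrightarrow> b = cball (x b) \<delta>"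
    and \<omega>: "\<And>b. b \<in> \<B> \<Longrightarrow> \<omega> b \<in> words n" "\<And>b. b \<in> \<B> \<Longrightarrow> x b \<in> word_map f (\<omega> b) ` K"
    by metis
  have "inj_on \<omega> \<B>"
  proof (rule inj_onI, rule ccontr)
    fix b b' assume b: "b \<in> \<B>" "b' \<in> \<B>" "\<omega> b = \<omega> b'" "b \<noteq> b'"
    obtain p q where pq: "p \<in> K" "q \<in> K" "x b = word_map f (\<omega> b) p" "x b' = word_map f (\<omega> b) q"
      using \<omega>(2) b by (metis imageE)
    have "dist (x b) (x b') = c ^ n * dist p q"
      unfolding pq(3,4) by (rule dist_word_map[OF \<omega>(1)[OF b(1)]])
    also have "\<dots> \<le> c ^ n * diameter K"
      using pq(1,2) K_compact c_pos
      by (intro mult_left_mono diameter_bounded_bound compact_imp_bounded) auto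
    finally have "x b' \<in> cball (x b) \<delta> \<inter> cball (x b') \<delta>"
      using \<delta> \<open>0 \<le> \<delta>\<close> by simp
    then have "b \<inter> b' \<noteq> {}"
      using x b by blast
    then show False
      using \<B>(2) b by (auto simp: disjoint_def)
  qed
  then have "card \<B> \<le> card (words n)"
    using \<omega>(1) finite_words by (intro card_inj_on_le) auto
  then show ?thesis
    by (simp add: card_words)
qed

lemma ball_packing_number_attained:
  assumes "c ^ n * diameter K \<le> \<delta>"
  obtains \<B> where "finite \<B>" "\<B> \<subseteq> (\<lambda>x. cball x \<delta>) ` K" "disjoint \<B>"
    "card \<B> = ball_packing_number \<delta> K"
    "\<And>\<B>'. finite \<B>' \<Longrightarrow> \<B>' \<subseteq> (\<lambda>x. cball x \<delta>) ` K \<Longrightarrow> disjoint \<B>' \<Longrightarrow> card \<B>' \<le> card \<B>"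
proof -
  let ?C = "{card \<B> | \<B>. finite \<B> \<and> \<B> \<subseteq> (\<lambda>x. cball x \<delta>) ` K \<and> disjoint \<B>}"
  have "?C \<subseteq> {..card I ^ n}"
    using card_packing_le[OF _ _ assms] by blast
  then have fin: "finite ?C"
    by (rule finite_subset) simp
  have "card ({} :: 'a set set) \<in> ?C"
    by (rule CollectI, rule exI[of _ "{}"]) simp
  then have ne: "?C \<noteq> {}"
    by blast
  have Sup: "ball_packing_number \<delta> K = Max ?C"
    unfolding ball_packing_number_def using fin ne by (rule cSup_eq_Max)
  have "Max ?C \<in> ?C"
    using fin ne by (rule Max_in)
  then obtain \<B> where \<B>: "finite \<B>" "\<B> \<subseteq> (\<lambda>x. cball x \<delta>) ` K" "disjoint \<B>"
    "card \<B> = Max ?C"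
    by auto
  have max: "card \<B>' \<le> Max ?C"
    if "finite \<B>'" "\<B>' \<subseteq> (\<lambda>x. cball x \<delta>) ` K" "disjoint \<B>'" for \<B>'
    using that fin by (intro Max_ge) auto
  show thesis
    by (rule that[OF \<B>(1-3)]) (simp_all only: \<B>(4) Sup max)
qed

text \<open>In a packing of maximal cardinality no further ball fits, so each \<open>word_map f \<omega> p\<close> lies within
  \<open>2 * \<delta>\<close> of one of its centres. Counting words by these centres gives the bound.\<close>

lemma card_words_le_packing:
  assumes p: "p \<in> K" and \<delta>: "0 < \<delta>" "c ^ n * diameter K \<le> \<delta>"
    and M: "\<And>x. card {\<omega> \<in> words n. word_map f \<omega> p \<in> cball x (2 * \<delta>)} \<le> M"
  shows "card I ^ n \<le> M * ball_packing_number \<delta> K"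
proof -
  obtain \<B> where \<B>: "finite \<B>" "\<B> \<subseteq> (\<lambda>x. cball x \<delta>) ` K" "disjoint \<B>"
    "card \<B> = ball_packing_number \<delta> K" and
    max: "\<And>\<B>'. finite \<B>' \<Longrightarrow> \<B>' \<subseteq> (\<lambda>x. cball x \<delta>) ` K \<Longrightarrow> disjoint \<B>' \<Longrightarrow> card \<B>' \<le> card \<B>"
    by (fact ball_packing_number_attained[OF \<delta>(2)])
  have "\<forall>b\<in>\<B>. \<exists>x. b = cball x \<delta>"
    using \<B>(2) by blast
  then obtain x where x: "\<And>b. b \<in> \<B> \<Longrightarrow> b = cball (x b) \<delta>"
    by metis
  let ?W = "\<lambda>b. {\<omega> \<in> words n. word_map f \<omega> p \<in> cball (x b) (2 * \<delta>)}"
  have "words n \<subseteq> (\<Union>b\<in>\<B>. ?W b)"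
  proof
    fix \<omega> assume \<omega>: "\<omega> \<in> words n"
    define y where "y = word_map f \<omega> p"
    have "y \<in> K"
      using word_pieces_cover[of n] \<omega> p unfolding y_def by blast
    have "\<exists>b\<in>\<B>. cball y \<delta> \<inter> b \<noteq> {}"
    proof (rule ccontr)
      assume none: "\<not> ?thesis"
      have "y \<in> cball y \<delta>"
        using \<delta> by simp
      then have "cball y \<delta> \<notin> \<B>"
        using none by blast
      moreover have "disjoint (insert (cball y \<delta>) \<B>)"
        using none \<B>(3) by (auto simp: disjoint_def)
      then have "card (insert (cball y \<delta>) \<B>) \<le> card \<B>"
        using \<B> \<open>y \<in> K\<close> by (intro max) auto
      ultimately show False
        using \<B>(1) by simp
    qed
    then obtain b z where b: "b \<in> \<B>" "z \<in> cball y \<delta>" "z \<in> b"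
      by blast
    then have "dist (x b) z \<le> \<delta>"
      using x[of b] by (metis mem_cball)
    then have "dist (x b) y \<le> 2 * \<delta>"
      using b(2) dist_triangle[of "x b" y z] by (simp add: dist_commute)
    then show "\<omega> \<in> (\<Union>b\<in>\<B>. ?W b)"
      using b(1) \<omega> by (auto simp: y_def)
  qed
  then have "card (words n) \<le> card (\<Union>b\<in>\<B>. ?W b)"
    using \<B>(1) finite_words by (intro card_mono) auto
  also have "\<dots> \<le> (\<Sum>b\<in>\<B>. card (?W b))"
    using \<B>(1) by (rule card_UN_le)
  also have "\<dots> \<le> (\<Sum>b\<in>\<B>. M)"
    by (intro sum_mono M)
  also have "\<dots> = M * ball_packing_number \<delta> K"
    using \<B>(4) by simp
  finally show ?thesis
    by (simp add: card_words)
qed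

section \<open>The two dimensions\<close>

text \<open>The least \<open>n\<close> satisfying the first inequality also satisfies the second: it is positive
  because \<open>\<delta> < D\<close>, and \<open>n - 1\<close> fails the first.\<close>

lemma exists_scale:
  assumes D: "0 < D" and \<delta>: "0 < \<delta>" "\<delta> < D"
  obtains n where "c ^ n * D \<le> \<delta>" "\<delta> * c < c ^ n * D"
proof -
  obtain m where "c ^ m < \<delta> / D"
    using real_arch_pow_inv[of "\<delta> / D" c] c_less_1 assms by auto
  then have ex: "c ^ m * D \<le> \<delta>"
    using D by (simp add: field_simps)
  define n where "n = (LEAST m. c ^ m * D \<le> \<delta>)"
  have n: "c ^ n * D \<le> \<delta>"
    unfolding n_def using ex by (rule LeastI)
  then have "n \<noteq> 0"
    using \<delta> by (intro notI) simp
  then obtain l where l: "n = Suc l"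
    using not0_implies_Suc by blast
  then have "\<not> c ^ l * D \<le> \<delta>"
    unfolding n_def by (intro not_less_Least) (simp flip: n_def)
  then have "\<delta> * c < c ^ n * D"
    using c_pos by (simp add: l mult.assoc mult.commute[of c])
  then show thesis
    using that n by blast
qed

theorem box_dim: "has_box_dim K (- ln (real (card I)) / ln c)"
proof -
  define s where "s = - ln (real (card I)) / ln c"
  obtain p where p: "p \<in> K"
    using K_nonempty by blast
  \<comment> \<open>Adding \<open>1\<close> keeps the reference scale positive for a one-point attractor.\<close>
  define D where "D = diameter K + 1"
  have diam: "0 \<le> diameter K"
    using K_compact by (intro diameter_ge_0 compact_imp_bounded)
  then have D: "D > 0"
    by (simp add: D_def)
  obtain M :: nat where
    M: "\<And>n x. card {\<omega> \<in> words n. word_map f \<omega> p \<in> cball x (2 * D / c * c ^ n)} \<le> M"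
    by (fact count_words_bounded)
  have lnc: "ln c < 0"
    using c_pos c_less_1 by simp
  \<comment> \<open>The first summand is the loss in the lower bound on the packing number, the second comes from
    replacing \<open>\<delta>\<close> by the scale \<open>c ^ n\<close>.\<close>
  define C where "C = ln (real M) + \<bar>s\<bar> * (\<bar>ln D\<bar> + \<bar>ln c\<bar>)"
  have "\<bar>ln (real (ball_packing_number \<delta> K)) - s * - ln \<delta>\<bar> \<le> C" if \<delta>: "0 < \<delta>" "\<delta> < D" for \<delta>
  proof -
    let ?N = "ball_packing_number \<delta> K"
    obtain n where n: "c ^ n * D \<le> \<delta>" "\<delta> * c < c ^ n * D"
      using exists_scale[OF D \<delta>] by blast
    have cn: "c ^ n > 0"
      using c_pos by simp
    have n': "c ^ n * diameter K \<le> \<delta>"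
      using n(1) cn by (simp add: D_def algebra_simps)
    have "?N \<le> card I ^ n"
      by (rule ball_packing_number_attained[OF n']) (metis card_packing_le[OF _ _ n'])
    then have upper: "real ?N \<le> real (card I) ^ n"
      by (metis of_nat_le_iff of_nat_power)
    have "2 * \<delta> \<le> 2 * D / c * c ^ n"
      using n(2) c_pos by (simp add: field_simps)
    then have "card {\<omega> \<in> words n. word_map f \<omega> p \<in> cball x (2 * \<delta>)} \<le> M" for x
      by (intro order_trans[OF card_mono M[of n x]]) (auto simp: finite_words)
    then have "card I ^ n \<le> M * ?N"
      by (rule card_words_le_packing[OF p \<delta>(1) n'])
    then have lower: "real (card I) ^ n \<le> real M * real ?N"
      by (metis of_nat_le_iff of_nat_mult of_nat_power)
    have kn: "real (card I) ^ n > 0"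
      using card_I_pos by simp
    then have "0 < real M * real ?N"
      using lower by linarith
    then have pos: "real M > 0" "real ?N > 0"
      by (simp_all add: zero_less_mult_iff)
    have "ln (real ?N) \<le> ln (real (card I) ^ n)"
      using upper pos kn by simp
    then have u: "ln (real ?N) \<le> n * ln (real (card I))"
      using card_I_pos by (simp add: ln_realpow)
    have "ln (real (card I) ^ n) \<le> ln (real M * real ?N)"
      using lower kn pos by simp
    then have l: "n * ln (real (card I)) \<le> ln (real M) + ln (real ?N)"
      using pos card_I_pos by (simp add: ln_realpow ln_mult)
    have "ln (c ^ n * D) \<le> ln \<delta>" "ln (\<delta> * c) \<le> ln (c ^ n * D)"
      using n D cn \<delta> c_pos by simp_all
    then have "n * ln c + ln D \<le> ln \<delta>" "ln \<delta> + ln c \<le> n * ln c + ln D"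
      using D \<delta> c_pos by (simp_all add: ln_mult ln_realpow)
    then have e: "\<bar>ln \<delta> - n * ln c\<bar> \<le> \<bar>ln D\<bar> + \<bar>ln c\<bar>"
      by linarith
    have k: "n * ln (real (card I)) = - s * (n * ln c)"
      using lnc by (simp add: s_def)
    have "\<bar>s * (ln \<delta> - n * ln c)\<bar> \<le> \<bar>s\<bar> * (\<bar>ln D\<bar> + \<bar>ln c\<bar>)"
      using e by (simp add: abs_mult mult_left_mono)
    moreover have "ln (real M) \<ge> 0"
      using pos by simp
    ultimately show ?thesis
      using u l k by (simp add: C_def right_diff_distrib)
  qed
  then have "eventually (\<lambda>\<delta>. \<bar>ln (real (ball_packing_number \<delta> K)) - s * - ln \<delta>\<bar> \<le> C) (at_right 0)"
    using D by (auto simp: eventually_at_right)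
  moreover have "filterlim (\<lambda>\<delta>::real. - ln \<delta>) at_top (at_right 0)"
    using ln_at_0 by (simp add: filterlim_uminus_at_top)
  ultimately show ?thesis
    unfolding has_box_dim_def s_def[symmetric] by (intro tendsto_quotient_of_bounded_error)
qed

lemma meeting_indices_natural: "meeting_indices (natural_structure I f K n) K = words n"
proof -
  have "word_map f \<omega> ` K \<inter> K \<noteq> {}" if "\<omega> \<in> words n" for \<omega>
    using word_pieces_cover[of n] that K_nonempty by blast
  then show ?thesis
    by (auto simp: meeting_indices_def natural_structure_def words_def)
qed

lemma diameter_word_piece:
  assumes "\<omega> \<in> words n"
  shows "diameter (word_map f \<omega> ` K) = c ^ n * diameter K"
proof (rule antisym)
  have bdd: "bounded K"
    using K_compact by (rule compact_imp_bounded)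
  have bdd': "bounded (word_map f \<omega> ` K)"
    using word_pieces_cover[of n] assms by (intro bounded_subset[OF bdd]) blast
  have cn: "c ^ n > 0"
    using c_pos by simp
  show "diameter (word_map f \<omega> ` K) \<le> c ^ n * diameter K"
  proof (rule diameter_le)
    fix x y assume "x \<in> word_map f \<omega> ` K" "y \<in> word_map f \<omega> ` K"
    then obtain p q where "p \<in> K" "q \<in> K" "x = word_map f \<omega> p" "y = word_map f \<omega> q"
      by blast
    then show "norm (x - y) \<le> c ^ n * diameter K"
      using cn dist_word_map[OF assms] diameter_bounded_bound[OF bdd] by (simp flip: dist_norm)
  qed (use K_nonempty in simp)
  have "diameter K \<le> diameter (word_map f \<omega> ` K) / c ^ n"
  proof (rule diameter_le)
    fix p q assume "p \<in> K" "q \<in> K"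
    then have "c ^ n * dist p q \<le> diameter (word_map f \<omega> ` K)"
      unfolding dist_word_map[OF assms, symmetric] by (intro diameter_bounded_bound[OF bdd']) auto
    then show "norm (p - q) \<le> diameter (word_map f \<omega> ` K) / c ^ n"
      using cn by (simp add: field_simps flip: dist_norm)
  qed (use K_nonempty in simp)
  then show "c ^ n * diameter K \<le> diameter (word_map f \<omega> ` K)"
    using cn by (simp add: field_simps)
qed

lemma level_count_natural: "level_count (natural_structure I f K n) K = card I ^ n"
  by (simp add: level_count_def meeting_indices_natural card_words)

lemma level_diam_natural: "level_diam (natural_structure I f K n) K = c ^ n * diameter K"
proof -
  have "words n \<noteq> {}"
    using card_words[of n] card_I_pos by (metis card.empty less_irrefl zero_less_power)
  moreover have "level_diam (natural_structure I f K n) K = (SUP \<omega>\<in>words n. c ^ n * diameter K)"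
    unfolding level_diam_def meeting_indices_natural
    by (intro SUP_cong) (auto simp: natural_structure_def diameter_word_piece)
  ultimately show ?thesis
    by simp
qed

text \<open>All words of length \<open>n\<close> fix the point of a one-point attractor, so \<open>card I ^ n\<close> is bounded.\<close>

lemma card_I_eq_1_if_diameter_0:
  assumes "diameter K = 0"
  shows "card I = 1"
proof -
  obtain p where p: "p \<in> K"
    using K_nonempty by blast
  obtain M :: nat where
    M: "\<And>n x. card {\<omega> \<in> words n. word_map f \<omega> p \<in> cball x (0 * c ^ n)} \<le> M"
    by (fact count_words_bounded)
  have eq: "q = p" if "q \<in> K" for q
    using diameter_bounded_bound[OF compact_imp_bounded[OF K_compact] p that] assms by simp
  have "word_map f \<omega> p = p" if "\<omega> \<in> words n" for n \<omega>
  proof (rule eq)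
    show "word_map f \<omega> p \<in> K"
      using word_pieces_cover[of n] that p by blast
  qed
  then have "{\<omega> \<in> words n. word_map f \<omega> p \<in> cball p (0 * c ^ n)} = words n" for n
    by auto
  then have bound: "card I ^ n \<le> M" for n
    using M[of n p] by (simp add: card_words)
  show ?thesis
  proof (rule ccontr)
    assume "card I \<noteq> 1"
    then have "M < card I ^ M"
      using card_I_pos by (intro power_gt_expt) simp
    then show False
      using bound[of M] by simp
  qed
qed

theorem fractal_dim2:
  "has_fractal_dim2 (natural_structure I f K) K (- ln (real (card I)) / ln c)"
proof (cases "diameter K = 0")
  case True
  \<comment> \<open>All level counts are \<open>1\<close>, so every numerator is \<open>ln 1 = 0\<close>, and so is the claimed limit.\<close>
  then show ?thesis
    by (simp add: has_fractal_dim2_def level_count_natural card_I_eq_1_if_diameter_0)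
next
  case False
  define s where "s = - ln (real (card I)) / ln c"
  have D: "diameter K > 0"
    using False diameter_ge_0[OF compact_imp_bounded[OF K_compact]] by simp
  have lnc: "ln c < 0"
    using c_pos c_less_1 by simp
  have h: "- ln (c ^ n * diameter K) = - ln (diameter K) + - ln c * real n" for n
    using D c_pos by (simp add: ln_mult ln_realpow)
  have "filterlim (\<lambda>n. - ln (c ^ n * diameter K)) at_top sequentially"
    unfolding h using lnc
    by (intro filterlim_tendsto_add_at_top[OF tendsto_const]
        filterlim_tendsto_pos_mult_at_top[OF tendsto_const] filterlim_real_sequentially) simp
  moreover have "\<bar>ln (real (card I ^ n)) - s * - ln (c ^ n * diameter K)\<bar> \<le> \<bar>s * ln (diameter K)\<bar>" for n
  proof -
    have "ln (real (card I ^ n)) = s * (- ln c * real n)"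
      using lnc card_I_pos by (simp add: s_def ln_realpow)
    then show ?thesis
      unfolding h by (simp add: algebra_simps)
  qed
  ultimately show ?thesis
    unfolding has_fractal_dim2_def level_count_natural level_diam_natural s_def[symmetric]
    by (intro tendsto_quotient_of_bounded_error always_eventually allI)
qed

end

theorem theorem3p1:
  fixes f :: "nat \<Rightarrow> real ^ 'n \<Rightarrow> real ^ 'n"
    and k :: nat and c :: real and K :: "(real ^ 'n) set"
  assumes "0 < c" and "c < 1"
    and "\<forall>i\<in>{1..k}. similarity c (f i)"
    and "open_set_condition {1..k} f"
    and "is_attractor {1..k} f K"
  shows "has_box_dim K (- ln (real k) / ln c) \<and>
         has_fractal_dim2 (natural_structure {1..k} f K) K (- ln (real k) / ln c)"
proof -
  interpret homogeneous_ifs "{1..k}" f c K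
    using assms by unfold_locales auto
  show ?thesis
    using box_dim fractal_dim2 by simp
qed

end
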